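(* On the board $\mathsf{Rhombus}(6)$, a maximal sweep has length $16$, and for every hole $v$ of $\mathsf{Rhombus}(6)$ there is a finite sequence of moves which starts from the position in which every hole except $v$ contains a peg, ends in a position with exactly one peg, and includes a maximal sweep (a sweep of length $16$) as one of its moves (not necessarily the last one).
   Context: Board: $\mathsf{Rhombus}(6)$ is the rhombus-shaped peg solitaire board with $6$ holes on each side on a triangular lattice. Equivalently, its $36$ holes are the pairs $(x,y)$ of integers with $1\le x,y\le 6$, and the six lattice directions are $\pm(1,0),\ \pm(0,1),\ \pm(1,1)$ (a $6\times 6$ square board with jumps additionally allowed along one of the two diagonal directions). Position: a board position is a subset of the holes, namely those holes that contain a peg; each hole contains at most one peg. Jump: if $d$ is one of the six directions, $p$, $p+d$, $p+2d$ are all holes of the board, $p$ and $p+d$ contain pegs and $p+2d$ is empty, then the peg at $p$ may jump to $p+2d$; the peg at $p+d$ is removed, so afterwards $p$ and $p+d$ are empty and $p+2d$ contains a peg. Move and sweep: a move is a sequence of one or more consecutive jumps made by the same peg (each jump after the first starts at the hole where the preceding jump ended). A single move that captures $m$ pegs (i.e. consists of $m$ jumps) is called a sweep of length $m$, or an $m$-sweep. A sweep is called maximal on a board if its length is the longest geometrically possible on that board, i.e. the largest length of a sweep that can be made starting from any board position whatsoever (whether or not that position can be reached in a game). *)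

theory Defs
  imports Main "HOL-Library.Product_Plus"
begin

type_synonym hole = "int \<times> int"

text \<open>A position is the set of the holes that contain a peg.\<close>
type_synonym position = "hole set"

definition rhombus :: "nat \<Rightarrow> hole set" where
  "rhombus n = {1..int n} \<times> {1..int n}"

definition directions :: "hole set" where
  "directions = {(1,0), (-1,0), (0,1), (0,-1), (1,1), (-1,-1)}"

definition can_jump :: "hole set \<Rightarrow> position \<Rightarrow> hole \<Rightarrow> hole \<Rightarrow> bool" where
  "can_jump B S p d \<longleftrightarrow> d \<in> directions
     \<and> p \<in> B \<and> p + d \<in> B \<and> p + d + d \<in> B
     \<and> p \<in> S \<and> p + d \<in> S \<and> p + d + d \<notin> S"

definition after_jump :: "position \<Rightarrow> hole \<Rightarrow> hole \<Rightarrow> position" where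
  "after_jump S p d = insert (p + d + d) (S - {p, p + d})"

text \<open>The peg at \<open>p\<close> makes consecutive jumps in the listed directions,
  turning position \<open>S\<close> into position \<open>T\<close>.\<close>
primrec jumps :: "hole set \<Rightarrow> hole list \<Rightarrow> hole \<Rightarrow> position \<Rightarrow> position \<Rightarrow> bool" where
  "jumps B [] p S T \<longleftrightarrow> T = S"
| "jumps B (d # ds) p S T \<longleftrightarrow>
     can_jump B S p d \<and> jumps B ds (p + d + d) (after_jump S p d) T"

text \<open>A move is given by the initial hole of the moving peg and the list of its jump directions.\<close>
type_synonym move = "hole \<times> hole list"

definition sweep_length :: "move \<Rightarrow> nat" where
  "sweep_length m = length (snd m)"

definition legal_move :: "hole set \<Rightarrow> move \<Rightarrow> position \<Rightarrow> position \<Rightarrow> bool" where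
  "legal_move B m S T \<longleftrightarrow> snd m \<noteq> [] \<and> jumps B (snd m) (fst m) S T"

primrec play :: "hole set \<Rightarrow> move list \<Rightarrow> position \<Rightarrow> position \<Rightarrow> bool" where
  "play B [] S T \<longleftrightarrow> T = S"
| "play B (m # ms) S T \<longleftrightarrow> (\<exists>U. legal_move B m S U \<and> play B ms U T)"

definition sweep_possible :: "hole set \<Rightarrow> nat \<Rightarrow> bool" where
  "sweep_possible B k \<longleftrightarrow> (\<exists>m S T. S \<subseteq> B \<and> legal_move B m S T \<and> sweep_length m = k)"

definition maximal_sweep_length :: "hole set \<Rightarrow> nat \<Rightarrow> bool" where
  "maximal_sweep_length B k \<longleftrightarrow> sweep_possible B k \<and> (\<forall>j. sweep_possible B j \<longrightarrow> j \<le> k)"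

end

(* A sweeping peg stays in its parity class modulo 2, which is a 3 x 3 grid. The holes it can
   capture are the midpoints of the lattice edges of this grid; there are 16 of them, and each is
   captured at most once. The graph has exactly two vertices of odd degree, so an Eulerian trail
   is a sweep of length 16.

   Games containing this sweep split at the sweep: after it, few pegs remain; before it, jumps read
   backwards are jumps of the complementary position, so the first half is a reduction of the
   complement to the single peg v. Up to the four symmetries of the rhombus there are twelve
   starting holes. *)
theory Submission
  imports Defs
begin

section \<open>The upper bound\<close>

text \<open>Kept as a list, so that \<open>distinct\<close> can express that no hole is captured
  twice.\<close>

primrec captured :: "hole list \<Rightarrow> hole \<Rightarrow> hole list" where
  "captured [] p = []"
| "captured (d # ds) p = (p + d) # captured ds (p + d + d)"

lemma length_captured: "length (captured ds p) = length ds"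
  by (induction ds arbitrary: p) auto

definition parity_class :: "hole \<Rightarrow> hole set" where
  "parity_class p = {q. even (fst q - fst p) \<and> even (snd q - snd p)}"

definition capturable :: "hole set \<Rightarrow> hole \<Rightarrow> hole set" where
  "capturable B p = {q + d |q d. d \<in> directions \<and> q \<in> parity_class p \<and> q \<in> B \<and> q + d + d \<in> B}"

lemma self_in_parity_class: "p \<in> parity_class p"
  by (simp add: parity_class_def)

lemma parity_class_jump: "parity_class (p + d + d) = parity_class p"
  by (auto simp: parity_class_def)

lemma capturable_jump: "capturable B (p + d + d) = capturable B p"
  by (simp add: capturable_def parity_class_jump)

text \<open>Every direction has an odd coordinate, so one step along it leaves the class.\<close>

lemma capturable_not_parity_class: "h \<in> capturable B p \<Longrightarrow> h \<notin> parity_class p"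
  by (auto simp: capturable_def parity_class_def directions_def)

text \<open>A sweep only ever fills landing holes, which stay in the class of \<open>p\<close> and
  so are never capturable. A captured hole is therefore not refilled during the sweep, and every
  captured peg was already present in \<open>S\<close>.\<close>

lemma captured_distinct:
  "jumps B ds p S T \<Longrightarrow>
     distinct (captured ds p) \<and> set (captured ds p) \<subseteq> S \<inter> capturable B p"
proof (induction ds arbitrary: p S)
  case Nil
  then show ?case by simp
next
  case (Cons d ds)
  have jump: "can_jump B S p d" and rest: "jumps B ds (p + d + d) (after_jump S p d) T"
    using Cons.prems by auto
  have first: "p + d \<in> S \<inter> capturable B p"
    using jump self_in_parity_class[of p] unfolding can_jump_def capturable_def by blast
  have landing: "p + d + d \<notin> capturable B p"
    using capturable_not_parity_class[of "p + d + d" B p] self_in_parity_class[of "p + d + d"]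
    by (auto simp: parity_class_jump)
  have tail: "distinct (captured ds (p + d + d))"
    "set (captured ds (p + d + d)) \<subseteq> after_jump S p d \<inter> capturable B p"
    using Cons.IH[OF rest] by (auto simp: capturable_jump)
  \<comment> \<open>The only hole that \<open>after_jump\<close> adds to \<open>S\<close> is the
    landing hole, excluded by \<open>landing\<close>; \<open>p + d\<close> itself has just been
    emptied.\<close>
  have "set (captured ds (p + d + d)) \<subseteq> S \<inter> capturable B p - {p + d}"
    using tail(2) landing by (auto simp: after_jump_def)
  then show ?case
    using first tail(1) by auto
qed

lemma length_le_card_capturable:
  assumes "jumps B ds p S T" "finite (capturable B p)"
  shows "length ds \<le> card (capturable B p)"
proof -
  have "length ds = card (set (captured ds p))"
    using captured_distinct[OF assms(1)] by (simp add: distinct_card length_captured)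
  also have "\<dots> \<le> card (capturable B p)"
    using captured_distinct[OF assms(1)] assms(2) by (intro card_mono) auto
  finally show ?thesis .
qed

text \<open>A midpoint of two grid points lies in the 5 x 5 box spanned by the grid, but is not
  itself a grid point. This inclusion is enough for the count.\<close>

lemma capturable_rhombus_6:
  "\<exists>a\<in>{1, 2}. \<exists>b\<in>{1, 2}. capturable (rhombus 6) p \<subseteq>
     {a..a + 4} \<times> {b..b + 4} - {a, a + 2, a + 4} \<times> {b, b + 2, b + 4}"
proof -
  \<comment> \<open>The representatives in {1, 2} of the two coordinates of \<open>p\<close> modulo
    2; \<open>(a, b)\<close> is the lowest corner of the 3 x 3 grid.\<close>
  define a b where "a = 2 - fst p mod 2" and "b = 2 - snd p mod 2"
  have range: "x \<in> {c, c + 2, c + 4}"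
    if "even (x - y)" "c = 2 - y mod 2" "1 \<le> x" "x \<le> 6" for x y c :: int
    using that by simp presburger
  have "h \<in> {a..a + 4} \<times> {b..b + 4} - {a, a + 2, a + 4} \<times> {b, b + 2, b + 4}"
    if h: "h \<in> capturable (rhombus 6) p" for h
  proof -
    obtain q d where hd: "h = q + d" and d: "d \<in> directions"
      and q: "q \<in> parity_class p" "q \<in> rhombus 6" and r: "q + d + d \<in> rhombus 6"
      using h by (auto simp: capturable_def)
    have r': "q + d + d \<in> parity_class p"
      using q(1) by (auto simp: parity_class_def)
    have grid: "fst s \<in> {a, a + 2, a + 4} \<and> snd s \<in> {b, b + 2, b + 4}"
      if "s \<in> parity_class p" "s \<in> rhombus 6" for s
      using that range[of "fst s" "fst p" a] range[of "snd s" "snd p" b]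
      by (auto simp: parity_class_def rhombus_def a_def b_def)
    have "h \<notin> parity_class p"
      using h by (rule capturable_not_parity_class)
    moreover have "s \<in> parity_class p" if "s \<in> {a, a + 2, a + 4} \<times> {b, b + 2, b + 4}" for s
      using that by (auto simp: parity_class_def a_def b_def)
    \<comment> \<open>Both ends of the jump are grid points, and the box is convex.\<close>
    moreover have "h \<in> {a..a + 4} \<times> {b..b + 4}"
      using grid[OF q] grid[OF r' r] d by (cases q) (auto simp: hd directions_def)
    ultimately show ?thesis by blast
  qed
  moreover have "a \<in> {1, 2}" "b \<in> {1, 2}"
    unfolding a_def b_def by auto
  ultimately show ?thesis by blast
qed

lemma card_capturable_rhombus_6:
  "finite (capturable (rhombus 6) p)" "card (capturable (rhombus 6) p) \<le> 16"
proof -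
  obtain a b :: int where ab: "a \<in> {1, 2}" "b \<in> {1, 2}" and
    sub: "capturable (rhombus 6) p \<subseteq>
      {a..a + 4} \<times> {b..b + 4} - {a, a + 2, a + 4} \<times> {b, b + 2, b + 4}" (is "_ \<subseteq> ?R")
    using capturable_rhombus_6[of p] by blast
  have "finite ?R" by simp
  then show "finite (capturable (rhombus 6) p)"
    using sub finite_subset by blast
  have "{a, a + 2, a + 4} \<times> {b, b + 2, b + 4} \<subseteq> {a..a + 4} \<times> {b..b + 4}" by auto
  \<comment> \<open>The count is 25 - 9.\<close>
  then have "card ?R = 16"
    by (subst card_Diff_subset) (auto simp: card_cartesian_product)
  then show "card (capturable (rhombus 6) p) \<le> 16"
    using card_mono[OF \<open>finite ?R\<close> sub] by simp
qed

lemma sweep_rhombus_6_le: "sweep_possible (rhombus 6) k \<Longrightarrow> k \<le> 16"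
  unfolding sweep_possible_def legal_move_def sweep_length_def
  using length_le_card_capturable card_capturable_rhombus_6 le_trans by blast

section \<open>Executing moves\<close>

text \<open>A functional form of \<open>jumps\<close>: the final position is computed, so concrete
  sweeps and games can be checked by evaluation.\<close>

primrec jumps_result :: "hole set \<Rightarrow> hole list \<Rightarrow> hole \<Rightarrow> position \<Rightarrow> position option" where
  "jumps_result B [] p S = Some S"
| "jumps_result B (d # ds) p S =
     (if can_jump B S p d then jumps_result B ds (p + d + d) (after_jump S p d) else None)"

primrec play_result :: "hole set \<Rightarrow> move list \<Rightarrow> position \<Rightarrow> position option" where
  "play_result B [] S = Some S"
| "play_result B (m # ms) S =
     (if snd m = [] then None
      else Option.bind (jumps_result B (snd m) (fst m) S) (play_result B ms))"

lemma jumps_result_iff: "jumps_result B ds p S = Some T \<longleftrightarrow> jumps B ds p S T"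
  by (induction ds arbitrary: p S) auto

lemma play_result_iff: "play_result B ms S = Some T \<longleftrightarrow> play B ms S T"
  by (induction ms arbitrary: S) (auto simp: legal_move_def jumps_result_iff bind_eq_Some_conv)

section \<open>The twelve games\<close>

text \<open>An Eulerian trail between the two grid corners of degree 3, from (1, 1) to (5, 5) when
  started at (1, 1). As a list of directions it can be translated to the other parity
  classes.\<close>

definition tour :: "hole list" where
  "tour = [
    (1, 0), (1, 0), (0, 1), (-1, 0), (-1, 0), (0, 1), (1, 0), (1, 0), (0, -1), (-1, -1),
    (0, 1), (0, 1), (-1, -1), (0, -1), (1, 1), (1, 1)]"

lemma sweep_possible_16: "sweep_possible (rhombus 6) 16"
proof -
  \<comment> \<open>The eight grid points other than the start are empty and all other holes are
    full, so every midpoint can be captured.\<close>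
  let ?S = "rhombus 6 - {(1, 3), (1, 5), (3, 1), (3, 3), (3, 5), (5, 1), (5, 3), (5, 5)}"
  have "jumps_result (rhombus 6) tour (1, 1) ?S \<noteq> None"
    by code_simp
  then obtain T where "jumps (rhombus 6) tour (1, 1) ?S T"
    by (auto simp: jumps_result_iff)
  moreover have "length tour = 16" "tour \<noteq> []"
    by (simp_all add: tour_def)
  ultimately show ?thesis
    unfolding sweep_possible_def legal_move_def sweep_length_def
    by (intro exI[of _ "((1, 1), tour)"] exI[of _ ?S] exI[of _ T]) auto
qed

definition winnable :: "hole \<Rightarrow> bool" where
  "winnable v \<longleftrightarrow> (\<exists>ms T. play (rhombus 6) ms (rhombus 6 - {v}) T \<and> card T = 1 \<and>
     (\<exists>m \<in> set ms. sweep_length m = 16))"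

lemma winnableI:
  assumes "map_option card (play_result (rhombus 6) ms (rhombus 6 - {v})) = Some 1"
    and "list_ex (\<lambda>m. sweep_length m = 16) ms"
  shows "winnable v"
  using assms unfolding winnable_def by (auto simp: play_result_iff list_ex_iff)

text \<open>Going from 35 pegs to 1 takes 34 captures: in each of the twelve games, 16 by the tour
  and 18 by single jumps.\<close>

lemma winnable_1_1: "winnable (1, 1)"
  by (rule winnableI[of "[
    ((1, 3), [(0, -1)]), ((3, 4), [(-1, -1)]), ((4, 3), [(-1, 0)]), ((4, 1), [(0, 1)]),
    ((6, 4), [(-1, -1)]), ((3, 1), [(1, 1)]), ((6, 2), [(-1, 0)]), ((5, 4), [(0, -1)]),
    ((6, 6), [(0, -1)]), ((6, 3), [(0, 1)]), ((5, 6), [(0, -1)]), ((6, 1), [(-1, 0)]),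
    ((1, 4), [(1, 0)]), ((1, 6), [(0, -1)]), ((4, 6), [(-1, -1)]), ((1, 1), tour),
    ((6, 5), [(-1, 0)]), ((2, 6), [(1, 0)]), ((4, 6), [(0, -1)])]"]) code_simp+

lemma winnable_1_2: "winnable (1, 2)"
  by (rule winnableI[of "[
    ((3, 4), [(-1, -1)]), ((1, 4), [(1, 0)]), ((2, 6), [(0, -1)]), ((4, 3), [(-1, 0)]),
    ((4, 1), [(0, 1)]), ((6, 1), [(-1, 0)]), ((4, 5), [(-1, 0)]), ((1, 3), [(1, 1)]),
    ((6, 3), [(0, -1)]), ((6, 4), [(-1, -1)]), ((3, 1), [(1, 0)]), ((4, 6), [(-1, -1)]),
    ((6, 5), [(-1, 0)]), ((6, 6), [(-1, 0)]), ((1, 6), [(0, -1)]), ((6, 1), [(-1, 0)]),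
    ((3, 6), [(1, 0)]), ((1, 1), tour), ((5, 6), [(0, -1)])]"]) code_simp+

lemma winnable_1_3: "winnable (1, 3)"
  by (rule winnableI[of "[
    ((1, 5), [(0, -1)]), ((1, 2), [(0, 1)]), ((3, 4), [(-1, -1)]), ((4, 3), [(-1, 0)]),
    ((4, 1), [(0, 1)]), ((6, 2), [(-1, 0)]), ((5, 4), [(0, -1)]), ((3, 6), [(0, -1)]),
    ((3, 1), [(1, 1)]), ((1, 6), [(1, 0)]), ((6, 4), [(-1, -1)]), ((5, 6), [(0, -1)]),
    ((6, 1), [(-1, 0)]), ((1, 1), tour), ((6, 6), [(0, -1)]), ((3, 6), [(1, 0)]),
    ((6, 3), [(0, 1)]), ((6, 5), [(-1, 0)]), ((5, 6), [(-1, -1)])]"]) code_simp+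

lemma winnable_1_4: "winnable (1, 4)"
  by (rule winnableI[of "[
    ((3, 4), [(-1, 0)]), ((1, 2), [(1, 1)]), ((2, 1), [(0, 1)]), ((4, 4), [(-1, -1)]),
    ((4, 6), [(0, -1)]), ((4, 3), [(0, 1)]), ((6, 3), [(-1, 0)]), ((6, 6), [(-1, -1)]),
    ((4, 1), [(-1, 0)]), ((6, 1), [(-1, 0)]), ((2, 6), [(1, 0)]), ((1, 4), [(0, -1)]),
    ((6, 5), [(0, -1)]), ((6, 2), [(0, 1)]), ((1, 6), [(0, -1)]), ((4, 6), [(-1, -1)]),
    ((1, 1), tour), ((5, 6), [(0, -1)]), ((6, 4), [(-1, 0)])]"]) code_simp+

text \<open>Here the tour runs in the class of (2, 2) and ends the game, so the 17 pegs before it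
  are exactly the sweeping peg and the 16 midpoints.\<close>

lemma winnable_1_5: "winnable (1, 5)"
  by (rule winnableI[of "[
    ((1, 3), [(0, 1)]), ((1, 1), [(0, 1)]), ((1, 6), [(0, -1)]), ((1, 3), [(0, 1)]),
    ((3, 4), [(-1, 0)]), ((5, 6), [(-1, -1)]), ((4, 3), [(0, 1)]), ((4, 1), [(0, 1)]),
    ((6, 4), [(-1, -1)]), ((6, 6), [(0, -1)]), ((2, 1), [(1, 0)]), ((5, 1), [(-1, 0)]),
    ((1, 4), [(0, 1)]), ((6, 3), [(0, 1)]), ((3, 6), [(1, 0)]), ((3, 1), [(1, 1)]),
    ((6, 1), [(0, 1)]), ((1, 6), [(1, 0)]), ((2, 2), tour)]"]) code_simp+

lemma winnable_1_6: "winnable (1, 6)"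
  by (rule winnableI[of "[
    ((1, 4), [(0, 1)]), ((1, 2), [(0, 1)]), ((3, 4), [(-1, -1)]), ((4, 3), [(-1, 0)]),
    ((4, 1), [(0, 1)]), ((6, 4), [(-1, -1)]), ((6, 6), [(0, -1)]), ((6, 3), [(0, 1)]),
    ((3, 6), [(0, -1)]), ((1, 6), [(1, 0)]), ((3, 1), [(1, 1)]), ((6, 2), [(-1, 0)]),
    ((5, 4), [(0, -1)]), ((5, 6), [(0, -1)]), ((6, 1), [(-1, 0)]), ((1, 1), tour),
    ((6, 5), [(-1, 0)]), ((3, 6), [(1, 0)]), ((5, 6), [(-1, -1)])]"]) code_simp+

lemma winnable_2_2: "winnable (2, 2)"
  by (rule winnableI[of "[
    ((4, 2), [(-1, 0)]), ((3, 4), [(0, -1)]), ((1, 4), [(1, 0)]), ((1, 6), [(0, -1)]),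
    ((4, 4), [(0, -1)]), ((4, 1), [(0, 1)]), ((6, 4), [(-1, -1)]), ((6, 1), [(-1, 0)]),
    ((6, 3), [(0, -1)]), ((3, 1), [(1, 0)]), ((4, 6), [(0, -1)]), ((6, 1), [(-1, 0)]),
    ((6, 6), [(-1, 0)]), ((4, 6), [(-1, -1)]), ((6, 5), [(-1, 0)]), ((3, 6), [(-1, 0)]),
    ((1, 3), [(0, 1)]), ((1, 6), [(0, -1)]), ((1, 1), tour)]"]) code_simp+

lemma winnable_2_3: "winnable (2, 3)"
  by (rule winnableI[of "[
    ((2, 1), [(0, 1)]), ((4, 2), [(-1, 0)]), ((3, 4), [(0, -1)]), ((3, 6), [(0, -1)]),
    ((1, 3), [(1, 1)]), ((4, 6), [(-1, -1)]), ((1, 6), [(1, 0)]), ((6, 4), [(-1, -1)]),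
    ((1, 5), [(1, 0)]), ((4, 1), [(-1, 0)]), ((6, 2), [(0, 1)]), ((4, 5), [(-1, 0)]),
    ((6, 1), [(-1, 0)]), ((6, 5), [(-1, 0)]), ((1, 1), tour), ((6, 6), [(-1, 0)]),
    ((3, 6), [(1, 0)]), ((5, 6), [(0, -1)]), ((6, 4), [(-1, 0)])]"]) code_simp+

lemma winnable_2_4: "winnable (2, 4)"
  by (rule winnableI[of "[
    ((2, 6), [(0, -1)]), ((2, 3), [(0, 1)]), ((2, 1), [(0, 1)]), ((4, 2), [(-1, 0)]),
    ((1, 2), [(1, 0)]), ((4, 4), [(-1, -1)]), ((6, 6), [(-1, -1)]), ((6, 4), [(-1, -1)]),
    ((1, 4), [(0, -1)]), ((4, 1), [(-1, 0)]), ((4, 6), [(-1, -1)]), ((6, 1), [(-1, 0)]),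
    ((1, 6), [(0, -1)]), ((1, 1), tour), ((6, 2), [(0, 1)]), ((6, 4), [(0, 1)]),
    ((6, 6), [(-1, 0)]), ((3, 6), [(1, 0)]), ((5, 6), [(0, -1)])]"]) code_simp+

lemma winnable_2_5: "winnable (2, 5)"
  by (rule winnableI[of "[
    ((4, 5), [(-1, 0)]), ((3, 3), [(0, 1)]), ((4, 3), [(0, 1)]), ((1, 4), [(1, 0)]),
    ((4, 1), [(0, 1)]), ((6, 1), [(-1, 0)]), ((4, 6), [(-1, -1)]), ((2, 6), [(1, 0)]),
    ((6, 4), [(-1, -1)]), ((3, 1), [(1, 1)]), ((6, 6), [(-1, -1)]), ((6, 2), [(0, 1)]),
    ((1, 3), [(1, 1)]), ((4, 6), [(-1, -1)]), ((6, 4), [(-1, -1)]), ((1, 6), [(0, -1)]),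
    ((1, 1), tour), ((6, 5), [(-1, 0)]), ((5, 6), [(-1, -1)])]"]) code_simp+

text \<open>Three single jumps follow the tour, collecting the three pegs left outside the swept
  holes.\<close>

lemma winnable_3_3: "winnable (3, 3)"
  by (rule winnableI[of "[
    ((1, 3), [(1, 0)]), ((1, 5), [(0, -1)]), ((3, 6), [(-1, -1)]), ((4, 5), [(-1, 0)]),
    ((4, 3), [(-1, 0)]), ((4, 1), [(0, 1)]), ((1, 3), [(1, 1)]), ((6, 4), [(-1, -1)]),
    ((6, 1), [(-1, 0)]), ((3, 1), [(1, 1)]), ((6, 5), [(-1, 0)]), ((6, 2), [(0, 1)]),
    ((6, 4), [(-1, -1)]), ((4, 6), [(-1, -1)]), ((6, 6), [(-1, 0)]), ((1, 1), tour),
    ((1, 6), [(1, 0)]), ((3, 6), [(1, 0)]), ((5, 6), [(0, -1)])]"]) code_simp+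

lemma winnable_3_4: "winnable (3, 4)"
  by (rule winnableI[of "[
    ((3, 6), [(0, -1)]), ((3, 3), [(0, 1)]), ((5, 3), [(-1, 0)]), ((1, 4), [(1, 0)]),
    ((2, 1), [(1, 1)]), ((4, 1), [(-1, 0)]), ((4, 4), [(-1, 0)]), ((1, 1), [(1, 0)]),
    ((6, 4), [(-1, 0)]), ((6, 1), [(-1, 0)]), ((3, 1), [(1, 0)]), ((5, 1), [(0, 1)]),
    ((1, 6), [(1, 0)]), ((4, 6), [(-1, 0)]), ((6, 2), [(0, 1)]), ((6, 6), [(-1, 0)]),
    ((1, 2), tour), ((6, 4), [(0, 1)]), ((6, 6), [(-1, 0)])]"]) code_simp+

section \<open>Symmetries\<close>

text \<open>An affine map \<open>f\<close> of the lattice with linear part \<open>g\<close>: holes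
  are moved by \<open>f\<close>, jump directions by \<open>g\<close>. Injectivity keeps empty
  landing holes empty.\<close>

locale board_symmetry =
  fixes B :: "hole set" and f g :: "hole \<Rightarrow> hole"
  assumes board: "f ` B = B"
    and inj: "inj f"
    and direction: "d \<in> directions \<Longrightarrow> g d \<in> directions"
    and step: "f (p + d) = f p + g d"
begin

lemma can_jump_image: "can_jump B S p d \<Longrightarrow> can_jump B (f ` S) (f p) (g d)"
  unfolding can_jump_def
  by (metis board direction inj inj_image_mem_iff step)

lemma after_jump_image: "f ` after_jump S p d = after_jump (f ` S) (f p) (g d)"
  by (simp add: after_jump_def image_set_diff[OF inj] step)

lemma jumps_image: "jumps B ds p S T \<Longrightarrow> jumps B (map g ds) (f p) (f ` S) (f ` T)"
  by (induction ds arbitrary: p S) (auto simp: can_jump_image after_jump_image[symmetric] step[symmetric])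

lemma play_image: "play B ms S T \<Longrightarrow> play B (map (map_prod f (map g)) ms) (f ` S) (f ` T)"
proof (induction ms arbitrary: S)
  case (Cons m ms)
  then obtain U where "legal_move B m S U" "play B ms U T" by auto
  then have "legal_move B (map_prod f (map g) m) (f ` S) (f ` U)"
    by (auto simp: legal_move_def jumps_image)
  then show ?case
    using Cons.IH[OF \<open>play B ms U T\<close>] by auto
qed simp

end

text \<open>The whole game is transported: \<open>f\<close> preserves the number of pegs, and
  mapping \<open>g\<close> over the directions preserves sweep lengths.\<close>

lemma winnable_symmetry:
  assumes "board_symmetry (rhombus 6) f g" "winnable v"
  shows "winnable (f v)"
proof -
  interpret board_symmetry "rhombus 6" f g by fact
  obtain ms T m where game: "play (rhombus 6) ms (rhombus 6 - {v}) T" "card T = 1"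
    and m: "m \<in> set ms" "sweep_length m = 16"
    using assms(2) by (auto simp: winnable_def)
  have "f ` (rhombus 6 - {v}) = rhombus 6 - {f v}"
    by (simp add: image_set_diff[OF inj] board)
  then have "play (rhombus 6) (map (map_prod f (map g)) ms) (rhombus 6 - {f v}) (f ` T)"
    using play_image[OF game(1)] by simp
  moreover have "card (f ` T) = 1"
    using game(2) inj by (simp add: card_image inj_on_subset)
  moreover have "map_prod f (map g) m \<in> set (map (map_prod f (map g)) ms)"
    using m(1) by simp
  moreover have "sweep_length (map_prod f (map g) m) = 16"
    using m(2) by (simp add: sweep_length_def)
  ultimately show ?thesis
    unfolding winnable_def by blast
qed

lemma swap_symmetry: "board_symmetry (rhombus 6) prod.swap prod.swap"
  by unfold_locales (auto simp: rhombus_def directions_def product_swap)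

lemma half_turn_symmetry: "board_symmetry (rhombus 6) (\<lambda>p. (7, 7) - p) uminus"
proof
  \<comment> \<open>The half turn is an involution, so the image of \<open>h\<close> is also its
    preimage.\<close>
  have "h \<in> (\<lambda>p. (7, 7) - p) ` rhombus 6" if "h \<in> rhombus 6" for h
    using that by (intro image_eqI[of _ _ "(7, 7) - h"]) (auto simp: rhombus_def)
  then show "(\<lambda>p. (7, 7) - p) ` rhombus 6 = rhombus 6"
    by (auto simp: rhombus_def)
qed (auto simp: directions_def inj_def)

lemma winnable_swap: "winnable (x, y) \<Longrightarrow> winnable (y, x)"
  using winnable_symmetry[OF swap_symmetry, of "(x, y)"] by simp

lemma winnable_half_turn: "winnable (x, y) \<Longrightarrow> winnable (7 - x, 7 - y)"
  using winnable_symmetry[OF half_turn_symmetry, of "(x, y)"] by simp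

lemma winnable_all:
  assumes "v \<in> rhombus 6"
  shows "winnable v"
proof -
  \<comment> \<open>A fundamental domain for the group generated by the swap and the half turn; it
    contains 6 + 4 + 2 = 12 holes.\<close>
  have lower: "winnable (x, y)" if "x \<le> y" "x + y \<le> 7" "1 \<le> x" for x y
  proof -
    have "x = 1 \<or> x = 2 \<or> x = 3" "y = 1 \<or> y = 2 \<or> y = 3 \<or> y = 4 \<or> y = 5 \<or> y = 6"
      using that by presburger+
    then show ?thesis
      using that winnable_1_1 winnable_1_2 winnable_1_3 winnable_1_4 winnable_1_5 winnable_1_6
        winnable_2_2 winnable_2_3 winnable_2_4 winnable_2_5 winnable_3_3 winnable_3_4
      by auto
  qed
  \<comment> \<open>The swap extends this to the half of the board with
    \<open>x + y \<le> 7\<close>; the half turn carries the remaining holes into that half.\<close>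
  have left: "winnable (x, y)" if "x + y \<le> 7" "1 \<le> x" "1 \<le> y" for x y
    using that lower[of x y] lower[of y x, THEN winnable_swap] by linarith
  obtain x y where v: "v = (x, y)" "1 \<le> x" "x \<le> 6" "1 \<le> y" "y \<le> 6"
    using assms by (auto simp: rhombus_def)
  show ?thesis
    using v left[of x y] left[of "7 - x" "7 - y", THEN winnable_half_turn]
    by (cases "x + y \<le> 7") auto
qed

theorem mainTheorem2:
  shows "maximal_sweep_length (rhombus 6) 16 \<and>
    (\<forall>v \<in> rhombus 6. \<exists>ms T. play (rhombus 6) ms (rhombus 6 - {v}) T \<and> card T = 1 \<and>
      (\<exists>m \<in> set ms. sweep_length m = 16))"
  using sweep_possible_16 sweep_rhombus_6_le winnable_all
  unfolding maximal_sweep_length_def winnable_def by blast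

end
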